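(* There exist a constant $\epsilon\in(0,1)$, a constant $c>0$ and an $n_0$ such that for every $n\ge n_0$, every algorithm that, given i.i.d. samples from an unknown distribution $p$ on $[n]$, distinguishes the following two cases with probability at least $2/3$ must use at least $c\,n/\log n$ samples: (1) there exist a distribution $\eta$ on $[n]$ and an $\alpha\in[0,\epsilon]$ such that $p=(1-\alpha)\,\mathcal U+\alpha\,\eta$; (2) there are no distribution $\eta$ on $[n]$ and $\alpha\in[0,1)$ such that $p=(1-\alpha)\,\mathcal U+\alpha\,\eta$ (i.e. such a representation is possible only with $\alpha=1$).
   Context: $[n]=\{1,\dots,n\}$ and $\mathcal U$ is the uniform distribution on $[n]$. The algorithm knows $n$; the noise distribution $\eta$ is arbitrary and the algorithm has no access to it. *)

theory Defs
  imports "HOL-Probability.Probability"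
begin

definition dist_on :: "nat \<Rightarrow> nat pmf \<Rightarrow> bool" where
  "dist_on n p \<longleftrightarrow> set_pmf p \<subseteq> {1..n}"

text \<open>\<open>p = (1 - \<alpha>) U + \<alpha> \<eta>\<close> as an identity of probability mass functions, with \<open>U\<close>
  uniform on \<open>{1..n}\<close>; only meant for \<open>n \<ge> 1\<close> and \<open>0 \<le> \<alpha> \<le> 1\<close>.\<close>
definition uniform_mixture :: "nat \<Rightarrow> real \<Rightarrow> nat pmf \<Rightarrow> nat pmf \<Rightarrow> bool" where
  "uniform_mixture n \<alpha> \<eta> p \<longleftrightarrow>
     (\<forall>i. pmf p i = (1 - \<alpha>) * pmf (pmf_of_set {1..n}) i + \<alpha> * pmf \<eta> i)"

definition low_noise :: "nat \<Rightarrow> real \<Rightarrow> nat pmf \<Rightarrow> bool" where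
  "low_noise n \<epsilon> p \<longleftrightarrow>
     (\<exists>\<eta> \<alpha>. dist_on n \<eta> \<and> \<alpha> \<in> {0..\<epsilon>} \<and> uniform_mixture n \<alpha> \<eta> p)"

definition pure_noise :: "nat \<Rightarrow> nat pmf \<Rightarrow> bool" where
  "pure_noise n p \<longleftrightarrow>
     \<not> (\<exists>\<eta> \<alpha>. dist_on n \<eta> \<and> \<alpha> \<in> {0..<1} \<and> uniform_mixture n \<alpha> \<eta> p)"

text \<open>A randomized algorithm maps the list of observed samples to a distribution over answers:
  \<open>True\<close> claims \<^const>\<open>low_noise\<close>, \<open>False\<close> claims \<^const>\<open>pure_noise\<close>. Below is the law of its
  answer on \<open>m\<close> independent samples from \<open>p\<close>.\<close>
definition answer :: "(nat list \<Rightarrow> bool pmf) \<Rightarrow> nat \<Rightarrow> nat pmf \<Rightarrow> bool pmf" where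
  "answer A m p = bind_pmf (replicate_pmf m p) A"

definition distinguishes :: "nat \<Rightarrow> real \<Rightarrow> nat \<Rightarrow> (nat list \<Rightarrow> bool pmf) \<Rightarrow> bool" where
  "distinguishes n \<epsilon> m A \<longleftrightarrow>
     (\<forall>p. dist_on n p \<longrightarrow>
        (low_noise n \<epsilon> p \<longrightarrow> measure_pmf.prob (answer A m p) {True} \<ge> 2 / 3) \<and>
        (pure_noise n p \<longrightarrow> measure_pmf.prob (answer A m p) {False} \<ge> 2 / 3))"

end

theory Submission
  imports Defs
begin

text \<open>A distribution that misses a point of \<open>{1..n}\<close> is pure noise, because a mixture with
  \<open>\<alpha> < 1\<close> has mass at least \<open>(1 - \<alpha>) / n\<close> at every point. So the uniform distribution
  on \<open>{2..n}\<close> is pure noise, while the uniform distribution on \<open>{1..n}\<close> is low noise for every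
  \<open>\<epsilon> \<ge> 0\<close>. A sample from the latter avoids the point \<open>1\<close> with probability \<open>1 - 1 / n\<close>, and given
  that it does, it is a sample from the former. So \<open>m\<close> samples all avoid \<open>1\<close> with probability
  \<open>(1 - 1 / n) ^ m \<ge> 1 - m / n\<close>, and an answer given with probability \<open>2 / 3\<close> on \<open>{2..n}\<close>
  is given with probability at least \<open>(1 - m / n) * 2 / 3\<close> on \<open>{1..n}\<close>. If it is the
  wrong answer on \<open>{1..n}\<close>, a distinguisher gives it there with probability at most \<open>1 / 3\<close>. Hence
  \<open>m \<ge> n / 2\<close>, which is at least \<open>n / (2 * ln n)\<close> once \<open>ln n \<ge> 1\<close>.

  The transfer between the two distributions is expressed by domination: \<open>a * pmf q x \<le> pmf p x\<close>
  for all \<open>x\<close> says that \<open>p\<close> behaves like \<open>q\<close> with probability at least \<open>a\<close>. Lemma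
  \<open>bind_pmf_dominates\<close> shows that the factors multiply along a random process, and so they
  become \<open>a ^ m\<close> for \<open>m\<close> independent samples.\<close>

lemma bind_pmf_dominates:
  fixes p q :: "'a pmf" and f g :: "'a \<Rightarrow> 'b pmf"
  assumes a: "0 \<le> a" and b: "0 \<le> b"
    and pq: "\<And>x. a * pmf q x \<le> pmf p x"
    and fg: "\<And>x. b * pmf (g x) y \<le> pmf (f x) y"
  shows "(a * b) * pmf (bind_pmf q g) y \<le> pmf (bind_pmf p f) y"
proof -
  have "ennreal ((a * b) * pmf (bind_pmf q g) y) =
      ennreal (a * b) * (\<integral>\<^sup>+x. ennreal (pmf q x) * ennreal (pmf (g x) y) \<partial>count_space UNIV)"
    using a b by (simp add: ennreal_mult ennreal_pmf_bind nn_integral_measure_pmf)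
  also have "\<dots> = (\<integral>\<^sup>+x. ennreal ((a * pmf q x) * (b * pmf (g x) y)) \<partial>count_space UNIV)"
    using a b by (subst nn_integral_cmult[symmetric])
      (auto intro!: nn_integral_cong simp: ennreal_mult mult_ac)
  also have "\<dots> \<le> (\<integral>\<^sup>+x. ennreal (pmf p x * pmf (f x) y) \<partial>count_space UNIV)"
    using a b pq fg by (intro nn_integral_mono ennreal_leI mult_mono) auto
  also have "\<dots> = ennreal (pmf (bind_pmf p f) y)"
    by (simp add: ennreal_mult ennreal_pmf_bind nn_integral_measure_pmf)
  finally show ?thesis
    by simp
qed

lemma replicate_pmf_dominates:
  assumes a: "0 \<le> a" and pq: "\<And>x. a * pmf q x \<le> pmf p x"
  shows "a ^ m * pmf (replicate_pmf m q) xs \<le> pmf (replicate_pmf m p) xs"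
proof (induction m arbitrary: xs)
  case 0
  show ?case by simp
next
  case (Suc m)
  have "(a * (a ^ m * 1)) * pmf (replicate_pmf (Suc m) q) xs \<le> pmf (replicate_pmf (Suc m) p) xs"
    unfolding replicate_pmf.simps using a Suc.IH pq
    by (intro bind_pmf_dominates) auto
  then show ?case by simp
qed

lemma answer_dominates:
  assumes "0 \<le> a" and "\<And>x. a * pmf q x \<le> pmf p x"
  shows "a ^ m * pmf (answer A m q) y \<le> pmf (answer A m p) y"
  using bind_pmf_dominates[of "a ^ m" 1 "replicate_pmf m q" "replicate_pmf m p" A y A]
    replicate_pmf_dominates[OF assms, of m] assms(1)
  by (simp add: answer_def)

lemma low_noise_uniform:
  assumes "1 \<le> n" and "0 \<le> \<epsilon>"
  shows "low_noise n \<epsilon> (pmf_of_set {1..n})"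
  unfolding low_noise_def
proof (intro exI conjI)
  show "dist_on n (pmf_of_set {1..n})"
    using assms by (simp add: dist_on_def)
  show "0 \<in> {0..\<epsilon>}"
    using assms by simp
  show "uniform_mixture n 0 (pmf_of_set {1..n}) (pmf_of_set {1..n})"
    by (simp add: uniform_mixture_def)
qed

lemma pure_noise_if_missing:
  assumes i: "i \<in> {1..n}" and missing: "i \<notin> set_pmf p"
  shows "pure_noise n p"
  unfolding pure_noise_def
proof clarify
  fix \<eta> :: "nat pmf" and \<alpha> :: real
  assume \<alpha>: "\<alpha> \<in> {0..<1}" and mix: "uniform_mixture n \<alpha> \<eta> p"
  have "0 < (1 - \<alpha>) * pmf (pmf_of_set {1..n}) i"
    using \<alpha> i by (auto simp: pmf_of_set)
  moreover have "0 \<le> \<alpha> * pmf \<eta> i"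
    using \<alpha> by simp
  ultimately have "0 < pmf p i"
    using mix unfolding uniform_mixture_def by (smt (verit))
  then show False
    using missing by (simp add: set_pmf_iff)
qed

theorem theorem7p1:
  shows "\<exists>(\<epsilon>::real) (c::real) (n\<^sub>0::nat). 0 < \<epsilon> \<and> \<epsilon> < 1 \<and> 0 < c \<and>
    (\<forall>n\<ge>n\<^sub>0. \<forall>(m::nat) (A :: nat list \<Rightarrow> bool pmf).
       distinguishes n \<epsilon> m A \<longrightarrow> real m \<ge> c * real n / ln (real n))"
proof -
  have bound: "1 / 2 * real n / ln (real n) \<le> real m"
    if n: "3 \<le> n" and dist: "distinguishes n (1 / 2) m A"
    for n m :: nat and A :: "nat list \<Rightarrow> bool pmf"
  proof -
    define p where "p = pmf_of_set {1..n}"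
    define q where "q = pmf_of_set {2..n}"
    have "dist_on n p" "dist_on n q" "1 \<notin> set_pmf q"
      using n by (auto simp: p_def q_def dist_on_def)
    moreover have "low_noise n (1 / 2) p"
      unfolding p_def using n by (intro low_noise_uniform) auto
    moreover have "pure_noise n q"
      using n \<open>1 \<notin> set_pmf q\<close> by (intro pure_noise_if_missing[of 1]) auto
    ultimately have true_p: "2 / 3 \<le> pmf (answer A m p) True"
      and false_q: "2 / 3 \<le> pmf (answer A m q) False"
      using dist by (auto simp: distinguishes_def measure_pmf_single)
    have "(1 - 1 / n) * pmf q x \<le> pmf p x" for x
      using n by (auto simp: p_def q_def pmf_of_set indicator_def field_simps of_nat_diff)
    then have "(1 - 1 / n) ^ m * pmf (answer A m q) False \<le> pmf (answer A m p) False"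
      using n by (intro answer_dominates) auto
    also have "\<dots> \<le> 1 / 3"
      using true_p by (simp add: pmf_False_conv_True)
    finally have "(1 - 1 / n) ^ m * pmf (answer A m q) False \<le> 1 / 3" .
    moreover have "(1 - 1 / n) ^ m * (2 / 3) \<le> (1 - 1 / n) ^ m * pmf (answer A m q) False"
      using n by (intro mult_left_mono false_q) auto
    ultimately have "(1 - 1 / n) ^ m * (2 / 3) \<le> 1 / 3"
      by linarith
    moreover have "1 - m / n \<le> (1 - 1 / n) ^ m"
      using Bernoulli_inequality[of "- 1 / real n" m] n by simp
    ultimately have "1 - m / n \<le> 1 / 2"
      by linarith
    then have "1 / 2 * real n \<le> m"
      using n by (simp add: field_simps)
    moreover have "1 \<le> ln (real n)"
      using n exp_le by (subst ln_ge_iff) linarith+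
    moreover from this have "1 / 2 * real n / ln (real n) \<le> 1 / 2 * real n / 1"
      by (intro divide_left_mono) auto
    ultimately show ?thesis
      by linarith
  qed
  show ?thesis
    using bound by (intro exI[of _ "1 / 2"] exI[of _ "3 :: nat"]) auto
qed

end
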